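(* Let $P\in\mathbb R[X]$ be a monic polynomial of degree $N=n+2m$ with distinct roots, whose Sturm functions $(P_0,P_1,\dots,P_{n+2m})$, $(Q_1,Q_2,\dots,Q_{n+2m})$ exist (as defined in the context). Let $x_1,\dots,x_n\in\mathbb R$ be the real roots of $P$ and $z_1,\dots,z_m$ its complex roots in the upper half plane $\mathcal H$. Let $\mathrm{Tri}(Q)$ be the symmetric tridiagonal $(n+2m)\times(n+2m)$ matrix over $\mathbb R(X)$ associated to $(Q_1,\dots,Q_{n+2m})$. Then in the Witt group $W(\mathbb R(X))$ $$[\mathrm{Tri}(Q)]=[X-x_1]+\dots+[X-x_n]+[P_{z_1}]+\dots+[P_{z_m}]-m[1] = n[1]+\sum_{i=1}^n([X-x_i]-[1])+\sum_{j=1}^m([P_{z_j}]-[1]).$$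
   Context: $\mathcal H=\{z\in\mathbb C : \mathrm{Im}(z)>0\}$, and for $z\in\mathcal H$, $P_z(X)=X^2-2\,\mathrm{Re}(z)X+|z|^2\in\mathbb R[X]$. Sturm functions of a degree $N$ polynomial $P\in\mathbb R[X]$: sequences of polynomials $P_0,\dots,P_N$ and $Q_1,\dots,Q_N$ in $\mathbb R[X]$ with $P_0=P$, $P_1=P'$ (derivative), $P_{k+1}=P_kQ_k-P_{k-1}$ for $1\le k\le N$, $\deg P_{k+1}<\deg P_k$, $P_N$ a nonzero constant and $P_{N+1}=0$. (Consequently $\deg P_k=N-k$ and $\deg Q_k=1$.) $\mathrm{Tri}(Q_1,\dots,Q_N)$ is the symmetric $N\times N$ matrix with diagonal entries $Q_1,\dots,Q_N$, entries $1$ immediately above and below the diagonal, and $0$ elsewhere. $W(K)$, for a field $K$ of characteristic $\ne 2$, is the Witt group of nonsingular symmetric bilinear forms on finite-dimensional $K$-vector spaces: the Grothendieck group of isomorphism classes under orthogonal direct sum, modulo the subgroup generated by the hyperbolic forms. $[S]\in W(K)$ is the class of an invertible symmetric matrix $S$ over $K$, and $[f]$ for $f\in K\setminus\{0\}$ is the class of the $1\times1$ matrix $(f)$. *)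

theory Defs
  imports
    "Jordan_Normal_Form.Matrix"
    "HOL-Computational_Algebra.Group_Closure"
    "HOL-Computational_Algebra.Polynomial_Factorial"
    Complex_Main
begin

section \<open>Isometry classes of nonsingular symmetric bilinear forms\<close>

text \<open>
  A nonsingular symmetric bilinear form on a finite-dimensional \<open>K\<close>-vector space is given by its
  Gram matrix, an invertible symmetric matrix over \<open>K\<close>; two forms are isomorphic iff their Gram
  matrices are congruent.  The space of dimension \<open>0\<close> (with its \<open>0 \<times> 0\<close> Gram matrix) is included.
\<close>

definition nonsingular_form :: "'a::field mat \<Rightarrow> bool" where
  "nonsingular_form S \<longleftrightarrow> square_mat S \<and> transpose_mat S = S \<and> invertible_mat S"

definition isometric :: "'a::field mat \<Rightarrow> 'a mat \<Rightarrow> bool" where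
  "isometric S T \<longleftrightarrow> nonsingular_form S \<and> nonsingular_form T \<and> dim_row S = dim_row T \<and>
     (\<exists>U \<in> carrier_mat (dim_row S) (dim_row S). invertible_mat U \<and> transpose_mat U * S * U = T)"

definition orth_sum :: "'a::field mat \<Rightarrow> 'a mat \<Rightarrow> 'a mat" where
  "orth_sum S T =
     four_block_mat S (0\<^sub>m (dim_row S) (dim_col T)) (0\<^sub>m (dim_row T) (dim_col S)) T"

text \<open>The hyperbolic form on \<open>V \<oplus> V*\<close>, where \<open>V\<close> has dimension \<open>n\<close>.\<close>

definition hyperbolic_mat :: "nat \<Rightarrow> 'a::field mat" where
  "hyperbolic_mat n = four_block_mat (0\<^sub>m n n) (1\<^sub>m n) (1\<^sub>m n) (0\<^sub>m n n)"

lemma invertible_mat_iff: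
  assumes "A \<in> carrier_mat n n"
  shows "invertible_mat A \<longleftrightarrow> (\<exists>B \<in> carrier_mat n n. A * B = 1\<^sub>m n \<and> B * A = 1\<^sub>m n)"
proof
  assume "invertible_mat A"
  then obtain B where B: "A * B = 1\<^sub>m n" "B * A = 1\<^sub>m (dim_row B)"
    using assms by (auto simp: invertible_mat_def inverts_mat_def)
  have "dim_col (A * B) = n" "dim_col (B * A) = dim_row B" using B by auto
  hence "B \<in> carrier_mat n n" using assms by auto
  thus "\<exists>B \<in> carrier_mat n n. A * B = 1\<^sub>m n \<and> B * A = 1\<^sub>m n" using B by auto
next
  assume "\<exists>B \<in> carrier_mat n n. A * B = 1\<^sub>m n \<and> B * A = 1\<^sub>m n"
  thus "invertible_mat A" using assms
    by (auto simp: invertible_mat_def inverts_mat_def)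
qed

lemma invertible_mat_mult:
  assumes A: "A \<in> carrier_mat n n" "invertible_mat A"
    and B: "B \<in> carrier_mat n n" "invertible_mat (B :: 'a::field mat)"
  shows "invertible_mat (A * B)"
proof -
  obtain A' where A': "A' \<in> carrier_mat n n" "A * A' = 1\<^sub>m n" "A' * A = 1\<^sub>m n"
    using A invertible_mat_iff by blast
  obtain B' where B': "B' \<in> carrier_mat n n" "B * B' = 1\<^sub>m n" "B' * B = 1\<^sub>m n"
    using B invertible_mat_iff by blast
  have "(A * B) * (B' * A') = A * (B * B') * A'"
    using A(1) B(1) A'(1) B'(1) by (simp add: assoc_mult_mat[of _ n n _ n _ n])
  moreover have "(B' * A') * (A * B) = B' * (A' * A) * B"
    using A(1) B(1) A'(1) B'(1) by (simp add: assoc_mult_mat[of _ n n _ n _ n])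
  ultimately have "(A * B) * (B' * A') = 1\<^sub>m n" "(B' * A') * (A * B) = 1\<^sub>m n"
    using A(1) A' B(1) B' by auto
  moreover have "B' * A' \<in> carrier_mat n n" using A'(1) B'(1) by simp
  ultimately show ?thesis
    unfolding invertible_mat_iff[OF mult_carrier_mat[OF A(1) B(1)]] by blast
qed

lemma invertible_mat_one: "invertible_mat (1\<^sub>m n :: 'a::field mat)"
  by (subst invertible_mat_iff[of _ n]) (auto intro!: bexI[of _ "1\<^sub>m n"])

lemma orth_sum_carrier [simp]:
  "S \<in> carrier_mat n n \<Longrightarrow> T \<in> carrier_mat m m \<Longrightarrow> orth_sum S T \<in> carrier_mat (n + m) (n + m)"
  by (auto simp: orth_sum_def)

lemma orth_sum_mult:
  assumes "A \<in> carrier_mat n n" "B \<in> carrier_mat n n" "C \<in> carrier_mat m m" "D \<in> carrier_mat m m"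
  shows "orth_sum A C * orth_sum B D = orth_sum (A * B) (C * D)"
  unfolding orth_sum_def
  using assms by (subst mult_four_block_mat[of _ n n _ m _ m _ _ n _ m]) auto

lemma orth_sum_transpose:
  assumes "A \<in> carrier_mat n n" "B \<in> carrier_mat m m"
  shows "transpose_mat (orth_sum A B) = orth_sum (transpose_mat A) (transpose_mat B)"
  unfolding orth_sum_def
  using assms by (subst transpose_four_block_mat[of _ n n _ m _ m]) auto

lemma orth_sum_one: "orth_sum (1\<^sub>m n) (1\<^sub>m m) = 1\<^sub>m (n + m)"
  by (simp add: orth_sum_def)

lemma orth_sum_invertible:
  assumes A: "A \<in> carrier_mat n n" "invertible_mat A" and B: "B \<in> carrier_mat m m" "invertible_mat B"
  shows "invertible_mat (orth_sum A B)"
proof -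
  obtain A' where A': "A' \<in> carrier_mat n n" "A * A' = 1\<^sub>m n" "A' * A = 1\<^sub>m n"
    using A invertible_mat_iff by blast
  obtain B' where B': "B' \<in> carrier_mat m m" "B * B' = 1\<^sub>m m" "B' * B = 1\<^sub>m m"
    using B invertible_mat_iff by blast
  show ?thesis using A(1) B(1) A' B'
    by (subst invertible_mat_iff[of _ "n + m"])
      (auto intro!: bexI[of _ "orth_sum A' B'"] simp: orth_sum_mult[of _ n _ _ m] orth_sum_one)
qed

lemma nonsingular_form_orth_sum:
  assumes "nonsingular_form S" "nonsingular_form T"
  shows "nonsingular_form (orth_sum S T)"
proof -
  have c: "S \<in> carrier_mat (dim_row S) (dim_row S)" "T \<in> carrier_mat (dim_row T) (dim_row T)"
    using assms by (auto simp: nonsingular_form_def)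
  show ?thesis
    using assms orth_sum_carrier[OF c] orth_sum_transpose[OF c] orth_sum_invertible[OF c(1) _ c(2)]
    by (auto simp: nonsingular_form_def)
qed

lemma isometricI:
  assumes "nonsingular_form S" "nonsingular_form T" "dim_row S = n" "dim_row T = n"
    "U \<in> carrier_mat n n" "invertible_mat U" "transpose_mat U * S * U = T"
  shows "isometric S T"
  using assms unfolding isometric_def by auto

lemma isometricE:
  assumes "isometric S T"
  obtains n U where "nonsingular_form S" "nonsingular_form T"
    "S \<in> carrier_mat n n" "T \<in> carrier_mat n n" "U \<in> carrier_mat n n" "invertible_mat U"
    "transpose_mat U * S * U = T"
proof -
  have ns: "nonsingular_form S" "nonsingular_form T" and d: "dim_row S = dim_row T"
    using assms unfolding isometric_def by auto
  have c: "S \<in> carrier_mat (dim_row S) (dim_row S)" "T \<in> carrier_mat (dim_row S) (dim_row S)"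
    using ns d by (auto simp: nonsingular_form_def)
  from assms obtain U where "U \<in> carrier_mat (dim_row S) (dim_row S)" "invertible_mat U"
    "transpose_mat U * S * U = T" unfolding isometric_def by blast
  from that[OF ns c this] show thesis .
qed

lemma isometric_refl:
  assumes "nonsingular_form S" shows "isometric S S"
proof -
  obtain n where c: "S \<in> carrier_mat n n" and n: "dim_row S = n"
    using assms by (auto simp: nonsingular_form_def)
  have "transpose_mat (1\<^sub>m n) * S * 1\<^sub>m n = S"
    by (simp only: transpose_one left_mult_one_mat[OF c] right_mult_one_mat[OF c])
  thus ?thesis
    by (rule isometricI[OF assms assms n n one_carrier_mat invertible_mat_one])
qed

lemma isometric_refl_iff: "isometric S S \<longleftrightarrow> nonsingular_form S"
  using isometric_refl by (auto simp: isometric_def)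

lemma isometric_sym:
  assumes "isometric S T" shows "isometric T S"
  using assms
proof (rule isometricE)
  fix n U
  assume ns: "nonsingular_form S" "nonsingular_form T"
    and c: "S \<in> carrier_mat n n" "T \<in> carrier_mat n n" "U \<in> carrier_mat n n"
    and U: "invertible_mat U" "transpose_mat U * S * U = T"
  obtain V where V: "V \<in> carrier_mat n n" "U * V = 1\<^sub>m n" "V * U = 1\<^sub>m n"
    using c U invertible_mat_iff by blast
  have tV: "transpose_mat V * transpose_mat U = 1\<^sub>m n"
    using V c by (simp flip: transpose_mult)
  have "transpose_mat V * T * V = (transpose_mat V * transpose_mat U) * S * (U * V)"
    unfolding U(2)[symmetric]
    using c V(1) by (simp add: assoc_mult_mat[of _ n n _ n _ n])
  also have "\<dots> = S" using tV V c by simp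
  finally have *: "transpose_mat V * T * V = S" .
  have "invertible_mat V" using V c by (auto simp: invertible_mat_iff[of _ n])
  thus ?thesis using isometricI[OF ns(2,1) _ _ V(1) _ *] c by auto
qed

lemma isometric_trans:
  assumes "isometric R S" "isometric S T" shows "isometric R T"
  using assms(1)
proof (rule isometricE)
  fix n U
  assume ns: "nonsingular_form R" "nonsingular_form S"
    and c: "R \<in> carrier_mat n n" "S \<in> carrier_mat n n" "U \<in> carrier_mat n n"
    and U: "invertible_mat U" "transpose_mat U * R * U = S"
  have nsT: "nonsingular_form T" using assms(2) by (simp add: isometric_def)
  have dT: "dim_row T = n" using assms(2) c by (auto simp: isometric_def)
  obtain V where V: "V \<in> carrier_mat n n" "invertible_mat V" "transpose_mat V * S * V = T"
    using assms(2) c unfolding isometric_def by auto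
  have "transpose_mat (U * V) * R * (U * V) = transpose_mat V * (transpose_mat U * R * U) * V"
    using c V(1) by (simp add: assoc_mult_mat[of _ n n _ n _ n] transpose_mult[of _ n n _ n])
  hence *: "transpose_mat (U * V) * R * (U * V) = T" using U V by simp
  show ?thesis
    by (rule isometricI[OF ns(1) nsT _ dT _ invertible_mat_mult[OF c(3) U(1) V(1,2)] *])
      (use c V in auto)
qed

lemma isometric_orth_sum:
  assumes "isometric S S'" "isometric T T'"
  shows "isometric (orth_sum S T) (orth_sum S' T')"
proof (rule isometricE[OF assms(1)], rule isometricE[OF assms(2)])
  fix n U m V
  assume S: "nonsingular_form S" "nonsingular_form S'"
    "S \<in> carrier_mat n n" "S' \<in> carrier_mat n n" "U \<in> carrier_mat n n" "invertible_mat U"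
    "transpose_mat U * S * U = S'"
  assume T: "nonsingular_form T" "nonsingular_form T'"
    "T \<in> carrier_mat m m" "T' \<in> carrier_mat m m" "V \<in> carrier_mat m m" "invertible_mat V"
    "transpose_mat V * T * V = T'"
  have d: "dim_row (orth_sum S T) = n + m" "dim_row (orth_sum S' T') = n + m"
    using orth_sum_carrier[OF S(3) T(3)] orth_sum_carrier[OF S(4) T(4)] by auto
  show ?thesis
    by (rule isometricI[OF nonsingular_form_orth_sum[OF S(1) T(1)]
          nonsingular_form_orth_sum[OF S(2) T(2)] d orth_sum_carrier[OF S(5) T(5)]
          orth_sum_invertible[OF S(5,6) T(5,6)]])
      (use S T in \<open>auto simp: orth_sum_transpose[of _ n _ m] orth_sum_mult[of _ n _ _ m]\<close>)
qed

lemma orth_sum_assoc: "orth_sum (orth_sum A B) C = orth_sum A (orth_sum B C)"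
  unfolding orth_sum_def by (rule assoc_four_block_mat[symmetric])

lemma isometric_orth_sum_commute:
  assumes "nonsingular_form S" "nonsingular_form T"
  shows "isometric (orth_sum S T) (orth_sum T S)"
proof -
  define n m where "n = dim_row S" and "m = dim_row T"
  have S: "S \<in> carrier_mat n n" and T: "T \<in> carrier_mat m m"
    using assms by (auto simp: nonsingular_form_def n_def m_def)
  define U :: "'a mat"
    where "U = four_block_mat (0\<^sub>m n m) (1\<^sub>m n) (1\<^sub>m m) (0\<^sub>m m n)"
  define V :: "'a mat"
    where "V = four_block_mat (0\<^sub>m m n) (1\<^sub>m m) (1\<^sub>m n) (0\<^sub>m n m)"
  have U: "U \<in> carrier_mat (n + m) (n + m)" and V: "V \<in> carrier_mat (n + m) (n + m)"
    unfolding U_def V_def by (auto simp: add.commute)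
  have UV: "U * V = 1\<^sub>m (n + m)" unfolding U_def V_def
    by (subst mult_four_block_mat[of _ n m _ n _ m _ _ n _ m]) auto
  have VU: "V * U = 1\<^sub>m (n + m)" unfolding U_def V_def
    by (subst mult_four_block_mat[of _ m n _ m _ n _ _ m _ n]) (auto simp: add.commute)
  have tU: "transpose_mat U = V" unfolding U_def V_def
    by (subst transpose_four_block_mat[of _ n m _ n _ m]) auto
  have inv: "invertible_mat U" using U V UV VU by (auto simp: invertible_mat_iff[of _ "n + m"])
  have 1: "V * orth_sum S T = four_block_mat (0\<^sub>m m n) T S (0\<^sub>m n m)"
    unfolding V_def orth_sum_def using S T
    by (subst mult_four_block_mat[of _ m n _ m _ n _ _ n _ m]) auto
  have 2: "V * orth_sum S T * U = orth_sum T S"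
    unfolding 1 unfolding U_def orth_sum_def using S T
    by (subst mult_four_block_mat[of _ m n _ m _ n _ _ m _ n]) auto
  have "transpose_mat U * orth_sum S T * U = orth_sum T S"
    using tU 2 by simp
  thus ?thesis
    using orth_sum_carrier[OF S T] orth_sum_carrier[OF T S]
    by (intro isometricI[OF nonsingular_form_orth_sum[OF assms]
          nonsingular_form_orth_sum[OF assms(2,1)] _ _ U inv]) auto
qed

lemma nonsingular_form_empty: "nonsingular_form (0\<^sub>m 0 0 :: 'a::field mat)"
  by (auto simp: nonsingular_form_def invertible_mat_iff[of _ 0] intro!: bexI[of _ "0\<^sub>m 0 0"])

lemma orth_sum_empty: "orth_sum (0\<^sub>m 0 0) S = S"
  unfolding orth_sum_def by (rule eq_matI) auto

lemma nonsingular_form_hyperbolic: "nonsingular_form (hyperbolic_mat n :: 'a::field mat)"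
proof -
  let ?H = "hyperbolic_mat n :: 'a mat"
  have c: "?H \<in> carrier_mat (n + n) (n + n)" by (simp add: hyperbolic_mat_def)
  have t: "transpose_mat ?H = ?H" unfolding hyperbolic_mat_def
    by (subst transpose_four_block_mat[of _ n n _ n _ n]) auto
  have "?H * ?H = 1\<^sub>m (n + n)" unfolding hyperbolic_mat_def
    by (subst mult_four_block_mat[of _ n n _ n _ n _ _ n _ n]) auto
  hence "invertible_mat ?H" using c unfolding invertible_mat_iff[OF c] by blast
  thus ?thesis using c t by (simp add: nonsingular_form_def)
qed

quotient_type (overloaded) 'a form_class = "'a::field mat" / partial: isometric
proof (rule part_equivpI)
  show "\<exists>S :: 'a mat. isometric S S"
    using isometric_refl nonsingular_form_empty by blast
  show "symp (isometric :: 'a mat \<Rightarrow> _)" by (rule sympI[OF isometric_sym])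
  show "transp (isometric :: 'a mat \<Rightarrow> _)" by (rule transpI[OF isometric_trans])
qed

instantiation form_class :: (field) comm_monoid_add
begin

lift_definition zero_form_class :: "'a form_class" is "0\<^sub>m 0 0"
  by (rule isometric_refl[OF nonsingular_form_empty])

lift_definition plus_form_class :: "'a form_class \<Rightarrow> 'a form_class \<Rightarrow> 'a form_class" is orth_sum
  by (rule isometric_orth_sum)

instance
proof
  fix a b c :: "'a form_class"
  show "a + b + c = a + (b + c)"
    by transfer (simp add: orth_sum_assoc isometric_refl_iff nonsingular_form_orth_sum)
  show "a + b = b + a"
    by transfer (simp add: isometric_refl_iff isometric_orth_sum_commute)
  show "0 + a = a"
    by transfer (simp add: orth_sum_empty)
qed

end


section \<open>The Grothendieck group of a commutative monoid\<close>

text \<open>The pair \<open>(a, b)\<close> represents the formal difference \<open>a - b\<close>.\<close>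

definition grothendieck_rel :: "'m::comm_monoid_add \<times> 'm \<Rightarrow> 'm \<times> 'm \<Rightarrow> bool" where
  "grothendieck_rel x y \<longleftrightarrow> (\<exists>u. fst x + snd y + u = fst y + snd x + u)"

lemma grothendieck_rel_trans:
  assumes "grothendieck_rel x y" "grothendieck_rel y z"
  shows "grothendieck_rel x z"
proof -
  obtain u v where u: "fst x + snd y + u = fst y + snd x + u"
    and v: "fst y + snd z + v = fst z + snd y + v"
    using assms by (auto simp: grothendieck_rel_def)
  have "fst x + snd z + (fst y + snd y + u + v)
      = (fst x + snd y + u) + (fst y + snd z + v)" by (simp add: ac_simps)
  also have "\<dots> = fst z + snd x + (fst y + snd y + u + v)"
    unfolding u v by (simp add: ac_simps)
  finally show ?thesis unfolding grothendieck_rel_def by blast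
qed

quotient_type (overloaded) 'm grothendieck =
  "'m::comm_monoid_add \<times> 'm" / grothendieck_rel
proof (rule equivpI)
  show "reflp (grothendieck_rel :: 'm \<times> 'm \<Rightarrow> _)"
    by (auto intro!: reflpI simp: grothendieck_rel_def)
  show "symp (grothendieck_rel :: 'm \<times> 'm \<Rightarrow> _)"
    unfolding grothendieck_rel_def by (rule sympI) metis
  show "transp (grothendieck_rel :: 'm \<times> 'm \<Rightarrow> _)"
    by (rule transpI[OF grothendieck_rel_trans])
qed

instantiation grothendieck :: (comm_monoid_add) ab_group_add
begin

lift_definition zero_grothendieck :: "'a grothendieck" is "(0, 0)" .

lift_definition plus_grothendieck :: "'a grothendieck \<Rightarrow> 'a grothendieck \<Rightarrow> 'a grothendieck"
  is "\<lambda>x y. (fst x + fst y, snd x + snd y)"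
proof -
  fix x x' y y' :: "'a \<times> 'a"
  assume "grothendieck_rel x x'" "grothendieck_rel y y'"
  then obtain u v where u: "fst x + snd x' + u = fst x' + snd x + u"
    and v: "fst y + snd y' + v = fst y' + snd y + v"
    by (auto simp: grothendieck_rel_def)
  have "(fst x + fst y) + (snd x' + snd y') + (u + v)
      = (fst x + snd x' + u) + (fst y + snd y' + v)" by (simp add: ac_simps)
  also have "\<dots> = (fst x' + fst y') + (snd x + snd y) + (u + v)"
    unfolding u v by (simp add: ac_simps)
  finally show "grothendieck_rel (fst x + fst y, snd x + snd y) (fst x' + fst y', snd x' + snd y')"
    unfolding grothendieck_rel_def by auto
qed

lift_definition uminus_grothendieck :: "'a grothendieck \<Rightarrow> 'a grothendieck"
  is "\<lambda>x. (snd x, fst x)"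
proof -
  fix x y :: "'a \<times> 'a"
  assume "grothendieck_rel x y"
  then obtain u where "fst x + snd y + u = fst y + snd x + u"
    by (auto simp: grothendieck_rel_def)
  hence "snd x + fst y + u = snd y + fst x + u" by (simp add: ac_simps)
  thus "grothendieck_rel (snd x, fst x) (snd y, fst y)"
    unfolding grothendieck_rel_def by auto
qed

definition minus_grothendieck :: "'a grothendieck \<Rightarrow> 'a grothendieck \<Rightarrow> 'a grothendieck" where
  "minus_grothendieck x y = x + (- y)"

instance
proof
  fix a b c :: "'a grothendieck"
  show "a + b + c = a + (b + c)"
    by transfer (auto simp: grothendieck_rel_def ac_simps)
  show "a + b = b + a"
    by transfer (auto simp: grothendieck_rel_def ac_simps)
  show "0 + a = a"
    by transfer (auto simp: grothendieck_rel_def ac_simps)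
  show "- a + a = 0"
    by transfer (auto simp: grothendieck_rel_def ac_simps)
  show "a - b = a + - b"
    by (rule minus_grothendieck_def)
qed

end

lift_definition grothendieck_of :: "'m::comm_monoid_add \<Rightarrow> 'm grothendieck" is "\<lambda>a. (a, 0)" .


section \<open>The Witt group\<close>

class field_char_ne_two = field +
  assumes two_ne_zero: "1 + 1 \<noteq> 0"

instance fract :: ("{idom, ring_char_0}") field_char_ne_two
proof
  have "(2 :: 'a) \<noteq> 0" by simp
  thus "(1 + 1 :: 'a fract) \<noteq> 0"
    by (simp add: One_fract_def Zero_fract_def eq_fract)
qed

definition hyperbolic_subgroup :: "'a::field form_class grothendieck set" where
  "hyperbolic_subgroup =
     group_closure (range (\<lambda>n. grothendieck_of (abs_form_class (hyperbolic_mat n))))"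

definition witt_rel ::
  "'a::field form_class grothendieck \<Rightarrow> 'a form_class grothendieck \<Rightarrow> bool" where
  "witt_rel x y \<longleftrightarrow> x - y \<in> hyperbolic_subgroup"

lemma witt_rel_refl: "witt_rel x x"
  by (simp add: witt_rel_def hyperbolic_subgroup_def)

lemma witt_rel_sym: "witt_rel x y \<Longrightarrow> witt_rel y x"
  unfolding witt_rel_def hyperbolic_subgroup_def
  using group_closure_minus_iff[of "x - y"] by simp

lemma witt_rel_add:
  assumes "witt_rel x x'" "witt_rel y y'" shows "witt_rel (x + y) (x' + y')"
proof -
  have "(x + y) - (x' + y') = (x - x') + (y - y')"
    by (simp only: add_diff_add)
  moreover have "(x - x') + (y - y') \<in> hyperbolic_subgroup"
    using assms unfolding witt_rel_def hyperbolic_subgroup_def by (rule group_closure_add)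
  ultimately show ?thesis by (simp only: witt_rel_def)
qed

lemma witt_rel_minus: "witt_rel x y \<Longrightarrow> witt_rel (- x) (- y)"
  using witt_rel_sym[of x y] by (simp add: witt_rel_def)

lemma witt_rel_trans: "witt_rel x y \<Longrightarrow> witt_rel y z \<Longrightarrow> witt_rel x z"
  using witt_rel_add[of x y y z] by (simp add: witt_rel_def)

quotient_type (overloaded) 'a witt = "'a::field_char_ne_two form_class grothendieck" / witt_rel
  by (rule equivpI[OF reflpI[OF witt_rel_refl] sympI[OF witt_rel_sym] transpI[OF witt_rel_trans]])

instantiation witt :: (field_char_ne_two) ab_group_add
begin

lift_definition zero_witt :: "'a witt" is 0 .

lift_definition plus_witt :: "'a witt \<Rightarrow> 'a witt \<Rightarrow> 'a witt" is "(+)"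
  by (rule witt_rel_add)

lift_definition uminus_witt :: "'a witt \<Rightarrow> 'a witt" is uminus
  by (rule witt_rel_minus)

definition minus_witt :: "'a witt \<Rightarrow> 'a witt \<Rightarrow> 'a witt" where
  "minus_witt x y = x + (- y)"

instance
proof
  fix a b c :: "'a witt"
  show "a + b + c = a + (b + c)" by transfer (simp add: witt_rel_refl add.assoc)
  show "a + b = b + a" by transfer (simp add: witt_rel_refl add.commute)
  show "0 + a = a" by transfer (simp add: witt_rel_refl)
  show "- a + a = 0" by transfer (simp add: witt_rel_refl)
  show "a - b = a + - b" by (rule minus_witt_def)
qed

end

text \<open>\<open>witt_class S\<close> is only meaningful if \<open>S\<close> satisfies \<^const>\<open>nonsingular_form\<close>.\<close>

definition witt_class :: "'a::field_char_ne_two mat \<Rightarrow> 'a witt" where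
  "witt_class S = abs_witt (grothendieck_of (abs_form_class S))"

definition witt_class1 :: "'a::field_char_ne_two \<Rightarrow> 'a witt" where
  "witt_class1 f = witt_class (mat 1 1 (\<lambda>_. f))"


section \<open>Sturm functions and tridiagonal matrices\<close>

text \<open>
  The condition \<open>deg P\<^sub>k\<^sub>+\<^sub>1 < deg P\<^sub>k\<close> is imposed for \<open>k < N\<close> only: for \<open>k = N\<close> it reads
  \<open>deg 0 < deg P\<^sub>N = 0\<close> with the convention \<open>deg 0 = -\<infinity>\<close>, whereas \<^term>\<open>degree 0 = (0 :: nat)\<close>.
  Only the values \<open>p 0, \<dots>, p (N + 1)\<close> and \<open>q 1, \<dots>, q N\<close> are relevant.
\<close>

definition sturm_functions ::
  "real poly \<Rightarrow> (nat \<Rightarrow> real poly) \<Rightarrow> (nat \<Rightarrow> real poly) \<Rightarrow> bool" where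
  "sturm_functions P p q \<longleftrightarrow>
     p 0 = P \<and> p 1 = pderiv P \<and>
     (\<forall>k \<in> {1..degree P}. p (k + 1) = p k * q k - p (k - 1)) \<and>
     (\<forall>k \<in> {1..<degree P}. degree (p (k + 1)) < degree (p k)) \<and>
     degree (p (degree P)) = 0 \<and> p (degree P) \<noteq> 0 \<and>
     p (degree P + 1) = 0"

text \<open>Matrix indices start at \<open>0\<close>, the sequence \<open>Q\<close> at \<open>1\<close>.\<close>

definition Tri :: "nat \<Rightarrow> (nat \<Rightarrow> 'a::{zero,one}) \<Rightarrow> 'a mat" where
  "Tri N Q = mat N N (\<lambda>(i, j).
     if i = j then Q (i + 1) else if i = j + 1 \<or> j = i + 1 then 1 else 0)"

definition upper_half_plane :: "complex set" where
  "upper_half_plane = {z. 0 < Im z}"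

definition quad_poly :: "complex \<Rightarrow> real poly" where
  "quad_poly z = [:(cmod z)\<^sup>2, - 2 * Re z, 1:]"

end

theory Submission
  imports Defs "Jordan_Normal_Form.Char_Poly"
begin

text \<open>
  At a complex root \<open>\<alpha>\<close> of \<open>P\<close> the recurrence makes \<open>v(\<alpha>) = ((-1)^k P_k(\<alpha>))\<close>, for
  \<open>k = 1, \<dots>, N\<close>, a kernel vector of \<open>Tri(Q)(\<alpha>)\<close>.  As the \<open>Q_k\<close> have degree \<open>1\<close>, the vectors
  \<open>v(\<alpha>) / P'(\<alpha>)\<close> diagonalise \<open>Tri(Q)\<close> over the complex numbers, with values \<open>X - \<alpha>\<close>.  Real
  combinations of the vectors for \<open>\<alpha>\<close> and its conjugate, with coefficients linear in \<open>X\<close>, turn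
  each pair of nonreal roots into the diagonal form with entries \<open>-1\<close> and \<open>P_\<alpha>\<close>; and
  \<open>[-1] = -[1]\<close> in the Witt group.
\<close>

section \<open>Witt classes\<close>

lemma isometric_imp_witt_class_eq: "isometric S T \<Longrightarrow> witt_class S = witt_class T"
  unfolding witt_class_def
  by (metis Quotient3_form_class Quotient3_rel_abs)

lemma witt_class_orth_sum:
  fixes S T :: "'a::field_char_ne_two mat"
  assumes "nonsingular_form S" "nonsingular_form T"
  shows "witt_class (orth_sum S T) = witt_class S + witt_class T"
proof -
  have "abs_form_class (orth_sum S T) = abs_form_class S + abs_form_class T"
    using assms by (simp add: plus_form_class.abs_eq isometric_refl)
  moreover have "grothendieck_of (a + b) = grothendieck_of a + grothendieck_of b"
    for a b :: "'a form_class"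
    by transfer (simp add: grothendieck_rel_def)
  ultimately show ?thesis
    by (simp add: witt_class_def plus_witt.abs_eq)
qed

lemma witt_class_empty: "witt_class (0\<^sub>m 0 0 :: 'a::field_char_ne_two mat) = 0"
proof -
  have "abs_form_class (0\<^sub>m 0 0 :: 'a mat) = 0" by (simp add: zero_form_class_def)
  moreover have "grothendieck_of (0 :: 'a form_class) = 0"
    by transfer (simp add: grothendieck_rel_def)
  ultimately show ?thesis by (simp add: witt_class_def zero_witt.abs_eq)
qed

lemma witt_class_hyperbolic: "witt_class (hyperbolic_mat n :: 'a::field_char_ne_two mat) = 0"
  unfolding witt_class_def zero_witt.abs_eq
  by (auto simp: witt.abs_eq_iff witt_rel_def hyperbolic_subgroup_def intro: group_closure.base)

lemma nonsingular_form_mat_1_1: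
  assumes "a \<noteq> 0"
  shows "nonsingular_form (mat 1 1 (\<lambda>_. a :: 'a::field))"
proof -
  have "mat 1 1 (\<lambda>_. a) * mat 1 1 (\<lambda>_. inverse a) = 1\<^sub>m 1"
    "mat 1 1 (\<lambda>_. inverse a) * mat 1 1 (\<lambda>_. a) = 1\<^sub>m 1"
    using assms by (auto intro!: eq_matI simp: scalar_prod_def)
  then have "invertible_mat (mat 1 1 (\<lambda>_. a))"
    by (subst invertible_mat_iff[of _ 1]) (auto intro!: bexI[of _ "mat 1 1 (\<lambda>_. inverse a)"])
  then show ?thesis
    by (auto simp: nonsingular_form_def intro!: eq_matI)
qed

text \<open>Only \<open>D\<close> is assumed invertible. From
  \<open>transpose_mat U * M * U = D\<close> the square matrix \<open>U\<close> has the left inverse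
  \<open>D' * transpose_mat U * M\<close>, hence a two-sided one, and \<open>M\<close> then has the
  inverse \<open>U * D' * transpose_mat U\<close>. Nonsingularity of \<open>Tri\<close> thus comes
  out of its diagonalisation.\<close>

lemma nonsingular_form_congruent:
  fixes M U D :: "'a::field mat"
  assumes M: "M \<in> carrier_mat n n" "transpose_mat M = M"
    and U: "U \<in> carrier_mat n n"
    and D: "nonsingular_form D" "transpose_mat U * M * U = D"
  shows "nonsingular_form M" "isometric M D"
proof -
  have cD: "D \<in> carrier_mat n n" using D(2) M U by auto
  obtain D' where D': "D' \<in> carrier_mat n n" "D * D' = 1\<^sub>m n" "D' * D = 1\<^sub>m n"
    using D(1) cD invertible_mat_iff unfolding nonsingular_form_def by blast
  define V where "V = D' * transpose_mat U * M"
  have cV: "V \<in> carrier_mat n n" using D'(1) U M by (auto simp: V_def)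
  have "V * U = D' * (transpose_mat U * M * U)"
    unfolding V_def using D'(1) U M by (simp add: assoc_mult_mat[of _ n n _ n _ n])
  then have VU: "V * U = 1\<^sub>m n" using D D' by simp
  have UV: "U * V = 1\<^sub>m n" by (rule mat_mult_left_right_inverse[OF cV U VU])
  have invU: "invertible_mat U" unfolding invertible_mat_iff[OF U] using cV UV VU by blast
  define W where "W = U * D' * transpose_mat U"
  have cW: "W \<in> carrier_mat n n" using D'(1) U by (auto simp: W_def)
  have "W * M = U * V" unfolding W_def V_def
    using D'(1) U M by (simp add: assoc_mult_mat[of _ n n _ n _ n])
  then have WM: "W * M = 1\<^sub>m n" using UV by simp
  have MW: "M * W = 1\<^sub>m n" by (rule mat_mult_left_right_inverse[OF cW M(1) WM])
  have "invertible_mat M" unfolding invertible_mat_iff[OF M(1)] using cW WM MW by blast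
  then show ns: "nonsingular_form M" using M by (auto simp: nonsingular_form_def)
  show "isometric M D"
    using ns D M(1) cD U invU by (intro isometricI[of _ _ n U]) auto
qed

lemma witt_class1_uminus_one: "witt_class1 (- 1 :: 'a::field_char_ne_two) = - witt_class1 1"
proof -
  let ?S = "mat 1 1 (\<lambda>_. 1 :: 'a)" and ?T = "mat 1 1 (\<lambda>_. - 1 :: 'a)"
  let ?h = "inverse (1 + 1 :: 'a)"
  have two: "(2 :: 'a) \<noteq> 0" using two_ne_zero[where 'a = 'a] by simp
  have h: "?h + ?h = 1"
    using two_ne_zero[where 'a = 'a] by (metis distrib_right mult_1 right_inverse)
  \<comment> \<open>The columns \<open>(1, 1)\<close> and \<open>(1/2, - 1/2)\<close> are isotropic
    for the diagonal form with entries \<open>1, - 1\<close> and pair to \<open>1\<close>, so they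
    form a hyperbolic basis.\<close>
  define U :: "'a mat" where
    "U = mat 2 2 (\<lambda>(i, j). if j = 0 then 1 else if i = 0 then ?h else - ?h)"
  have ns: "nonsingular_form ?S" "nonsingular_form ?T"
    by (auto intro!: nonsingular_form_mat_1_1[unfolded One_nat_def])
  have S: "orth_sum ?S ?T = mat 2 2 (\<lambda>(i, j). if i = j then if i = 0 then 1 else - 1 else 0)"
    by (rule eq_matI) (auto simp: orth_sum_def four_block_mat_def Let_def)
  have "transpose_mat U * orth_sum ?S ?T * U = hyperbolic_mat 1"
    unfolding S
    by (rule eq_matI)
      (auto simp: U_def hyperbolic_mat_def four_block_mat_def Let_def scalar_prod_def
        numeral_2_eq_2 less_Suc_eq algebra_simps h two)
  then have "isometric (orth_sum ?S ?T) (hyperbolic_mat 1)"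
    unfolding S
    by (intro nonsingular_form_congruent(2)[of _ 2 U] nonsingular_form_hyperbolic)
      (auto simp: U_def)
  then have "witt_class1 1 + witt_class1 (- 1 :: 'a) = 0"
    unfolding witt_class1_def
    using isometric_imp_witt_class_eq witt_class_orth_sum[OF ns] witt_class_hyperbolic by metis
  then show ?thesis by (metis add.inverse_unique)
qed

lemma witt_class_diagonal:
  fixes d :: "nat \<Rightarrow> 'a::field_char_ne_two"
  assumes "\<And>i. i < n \<Longrightarrow> d i \<noteq> 0"
  defines "D \<equiv> \<lambda>n. mat n n (\<lambda>(i, j). if i = j then d i else 0)"
  shows "nonsingular_form (D n) \<and> witt_class (D n) = (\<Sum>i<n. witt_class1 (d i))"
  using assms(1)
proof (induction n)
  case 0
  have "D 0 = 0\<^sub>m 0 0" by (auto simp: D_def)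
  then show ?case by (simp add: nonsingular_form_empty witt_class_empty)
next
  case (Suc n)
  have "D (Suc n) = orth_sum (D n) (mat 1 1 (\<lambda>_. d n))"
    by (rule eq_matI) (auto simp: D_def orth_sum_def four_block_mat_def Let_def less_Suc_eq)
  moreover have "nonsingular_form (mat 1 1 (\<lambda>_. d n))"
    by (rule nonsingular_form_mat_1_1) (use Suc.prems in auto)
  ultimately show ?case
    using Suc by (simp add: nonsingular_form_orth_sum witt_class_orth_sum witt_class1_def)
qed

section \<open>Eigenvectors of the tridiagonal matrix\<close>

text \<open>The signs turn the recurrence, where \<open>p (k - 1)\<close> is subtracted, into one
  where both neighbours are added, matching the entries \<open>1\<close> beside the diagonal. Index
  \<open>i\<close> belongs to \<open>p (Suc i)\<close> because matrix indices start at
  \<open>0\<close>.\<close>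

definition sturm_vec :: "(nat \<Rightarrow> 'a poly) \<Rightarrow> 'a \<Rightarrow> nat \<Rightarrow> 'a::comm_ring_1" where
  "sturm_vec p s i = (- 1) ^ Suc i * poly (p (Suc i)) s"

text \<open>The entry \<open>v\<^sub>0 = poly (p 0) s\<close> that the matrix does not see causes the defect at \<open>i = 0\<close>.\<close>

lemma Tri_sturm_vec:
  fixes p q :: "nat \<Rightarrow> 'a::comm_ring_1 poly"
  assumes rec: "\<And>k. k \<in> {1..N} \<Longrightarrow> p (k + 1) = p k * q k - p (k - 1)"
    and last: "p (N + 1) = 0"
    and deg: "\<And>k. k \<in> {1..N} \<Longrightarrow> degree (q k) \<le> 1"
    and i: "i < N"
  shows "(\<Sum>j<N. Tri N (\<lambda>k. poly (q k) t) $$ (i, j) * sturm_vec p s j)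
     = (t - s) * coeff (q (Suc i)) 1 * sturm_vec p s i - (if i = 0 then poly (p 0) s else 0)"
proof -
  let ?v = "sturm_vec p s"
  let ?f = "\<lambda>j. (if j = i then poly (q (Suc i)) t * ?v i else 0)
     + (if i = j + 1 then ?v j else 0) + (if j = Suc i then ?v j else 0)"
  have "(\<Sum>j<N. Tri N (\<lambda>k. poly (q k) t) $$ (i, j) * ?v j) = (\<Sum>j<N. ?f j)"
    by (rule sum.cong) (use i in \<open>auto simp: Tri_def\<close>)
  also have "\<dots> = poly (q (Suc i)) t * ?v i + (if i = 0 then 0 else ?v (i - 1))
      + (if Suc i < N then ?v (Suc i) else 0)"
  proof -
    have "(\<Sum>j<N. if i = j + 1 then ?v j else 0) = (if i = 0 then 0 else ?v (i - 1))"
      using i by (cases i) auto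
    then show ?thesis using i by (simp add: sum.distrib)
  qed
  \<comment> \<open>The last row has no right neighbour; the term may still be written because
    \<open>p (N + 1) = 0\<close>.\<close>
  also have "(if Suc i < N then ?v (Suc i) else 0) = ?v (Suc i)"
    using i last by (auto simp: sturm_vec_def not_less less_Suc_eq_le dest!: le_antisym)
  finally have 1: "(\<Sum>j<N. Tri N (\<lambda>k. poly (q k) t) $$ (i, j) * ?v j)
     = poly (q (Suc i)) t * ?v i + (if i = 0 then 0 else ?v (i - 1)) + ?v (Suc i)" .
  have "degree (q (Suc i)) \<le> 1" using i by (intro deg) auto
  then have "q (Suc i) = [:coeff (q (Suc i)) 0, coeff (q (Suc i)) 1:]"
    by (intro poly_eqI) (auto simp: coeff_pCons coeff_eq_0 split: nat.splits)
  \<comment> \<open>Since \<open>q (Suc i)\<close> is linear, passing from \<open>s\<close> to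
    \<open>t\<close> costs only a multiple of \<open>t - s\<close>.\<close>
  then have 2: "poly (q (Suc i)) t = poly (q (Suc i)) s + (t - s) * coeff (q (Suc i)) 1"
    by (metis (no_types, lifting) add.right_neutral add_diff_cancel_left' diff_add_eq
        left_diff_distrib mult_zero_right poly_0 poly_pCons add.assoc diff_add_cancel)
  have "poly (p (Suc (Suc i))) s = poly (p (Suc i)) s * poly (q (Suc i)) s - poly (p i) s"
    using rec[of "Suc i"] i by simp
  then have "poly (q (Suc i)) s * ?v i + ?v (Suc i) = (- 1) ^ i * - poly (p i) s"
    by (simp add: sturm_vec_def right_diff_distrib mult_ac)
  also have "(- 1) ^ i * - poly (p i) s
      = - (if i = 0 then poly (p 0) s else ?v (i - 1))"
    by (cases i) (auto simp: sturm_vec_def)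
  finally have 3: "?v (Suc i)
      = - (if i = 0 then poly (p 0) s else ?v (i - 1)) - poly (q (Suc i)) s * ?v i"
    by (metis add_diff_cancel_left')
  show ?thesis unfolding 1 2 3 by (simp add: algebra_simps)
qed

text \<open>
  Symmetry of the matrix gives a Christoffel-Darboux identity: it makes eigenvectors for different
  roots orthogonal, and its derivative yields their norms.
\<close>

lemma sturm_vec_orthogonal:
  fixes p q :: "nat \<Rightarrow> 'a::field_char_0 poly"
  assumes rec: "\<And>k. k \<in> {1..N} \<Longrightarrow> p (k + 1) = p k * q k - p (k - 1)"
    and last: "p (N + 1) = 0"
    and deg: "\<And>k. k \<in> {1..N} \<Longrightarrow> degree (q k) \<le> 1"
    and N: "0 < N"
    and r: "poly (p 0) r = 0" and s: "poly (p 0) s = 0"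
  shows "(\<Sum>i<N. \<Sum>j<N. sturm_vec p r i * Tri N (\<lambda>k. poly (q k) t) $$ (i, j) * sturm_vec p s j)
     = (if r = s then (t - s) * (poly (pderiv (p 0)) s * poly (p 1) s) else 0)"
proof -
  let ?T = "\<lambda>t i j. Tri N (\<lambda>k. poly (q k) t) $$ (i, j)"
  define B where "B t r s = (\<Sum>i<N. \<Sum>j<N. sturm_vec p r i * ?T t i j * sturm_vec p s j)" for t r s
  define S where "S r s = (\<Sum>i<N. coeff (q (Suc i)) 1 * sturm_vec p r i * sturm_vec p s i)" for r s
  \<comment> \<open>The row defect occurs only at \<open>i = 0\<close>, where it meets
    \<open>sturm_vec p r 0\<close>, that is \<open>- poly (p 1) r\<close>; hence the plus
    sign.\<close>
  have B: "B t r s = (t - s) * S r s + poly (p 0) s * poly (p 1) r" for t r s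
  proof -
    have "B t r s = (\<Sum>i<N. sturm_vec p r i * (\<Sum>j<N. ?T t i j * sturm_vec p s j))"
      by (simp add: B_def sum_distrib_left mult.assoc)
    also have "\<dots> = (\<Sum>i<N. (t - s) * (coeff (q (Suc i)) 1 * sturm_vec p r i * sturm_vec p s i)
        - (if i = 0 then poly (p 0) s * sturm_vec p r 0 else 0))"
    proof (rule sum.cong[OF refl])
      fix i assume "i \<in> {..<N}"
      then have i: "i < N" by simp
      show "sturm_vec p r i * (\<Sum>j<N. ?T t i j * sturm_vec p s j)
        = (t - s) * (coeff (q (Suc i)) 1 * sturm_vec p r i * sturm_vec p s i)
          - (if i = 0 then poly (p 0) s * sturm_vec p r 0 else 0)"
        using Tri_sturm_vec[where p = p and q = q and N = N and t = t and s = s,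
            OF rec last deg i]
        by (simp add: right_diff_distrib mult_ac)
    qed
    also have "\<dots> = (t - s) * S r s + poly (p 0) s * poly (p 1) r"
      using N by (simp add: sum_subtractf S_def sum_distrib_left sturm_vec_def)
    finally show ?thesis .
  qed
  have Bsym: "B t r s = B t s r" for t r s
    unfolding B_def by (subst sum.swap) (auto intro!: sum.cong simp: Tri_def)
  have Ssym: "S r s = S s r" for r s
    unfolding S_def by (auto intro!: sum.cong)
  have CD: "(r - s) * S r s = poly (p 0) r * poly (p 1) s - poly (p 0) s * poly (p 1) r" for r s
    using B[of 0 r s] B[of 0 s r] Bsym[of 0 r s] Ssym[of r s] by (simp add: algebra_simps)
  have Bst: "B t r s = (t - s) * S r s" using B s by simp
  show ?thesis
  proof (cases "r = s")
    case False
    then have "S r s = 0" using CD[of r s] r s by simp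
    then show ?thesis using Bst False by (simp add: B_def)
  next
    case True
    \<comment> \<open>\<open>R\<close> is \<open>S u s\<close> as a polynomial in \<open>u\<close>,
      so that the identity \<open>CD\<close> can be differentiated at \<open>u = s\<close>, where it
      is trivial as it stands.\<close>
    define R where "R = (\<Sum>i<N. smult (coeff (q (Suc i)) 1 * (- 1) ^ Suc i * sturm_vec p s i) (p (Suc i)))"
    have R: "poly R u = S u s" for u
      by (simp add: R_def S_def poly_sum sturm_vec_def mult_ac)
    have "poly ([:- s, 1:] * R) u = poly (smult (poly (p 1) s) (p 0)) u" for u
      using CD[of u s] s by (simp add: R algebra_simps)
    then have "[:- s, 1:] * R = smult (poly (p 1) s) (p 0)"
      by (simp add: poly_eq_poly_eq_iff[symmetric] fun_eq_iff)
    then have "poly (pderiv ([:- s, 1:] * R)) s = poly (pderiv (smult (poly (p 1) s) (p 0))) s"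
      by simp
    moreover have "poly (pderiv ([:- s, 1:] * R)) s = poly R s"
      by (simp add: pderiv_mult pderiv_pCons del: mult_pCons_left)
    ultimately have "poly R s = poly (p 1) s * poly (pderiv (p 0)) s"
      by (simp add: pderiv_smult)
    then show ?thesis using Bst True R by (simp add: B_def)
  qed
qed


section \<open>Real columns\<close>

text \<open>Starting from degree at most \<open>N - 1\<close> at \<open>k = 1\<close>, the degrees
  drop strictly until \<open>k = N\<close>, which leaves room only for
  \<open>degree (p k) = N - k\<close>. Then \<open>p k * q k\<close> has degree at most
  \<open>N - k + 1\<close>.\<close>

lemma sturm_degree_le_1:
  assumes st: "sturm_functions P p q" and k: "k \<in> {1..degree P}"
  shows "degree (q k) \<le> 1"
proof -
  define N where "N = degree P"
  have p0: "p 0 = P" "p 1 = pderiv P"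
    and rec: "\<And>k. k \<in> {1..N} \<Longrightarrow> p (k + 1) = p k * q k - p (k - 1)"
    and dec: "\<And>k. k \<in> {1..<N} \<Longrightarrow> degree (p (k + 1)) < degree (p k)"
    and last: "p N \<noteq> 0" "p (N + 1) = 0"
    using st by (auto simp: sturm_functions_def N_def)
  have upper: "degree (p k) \<le> N - k" if "k \<le> N" for k
    using that
  proof (induction k)
    case 0
    then show ?case by (simp add: p0 N_def)
  next
    case (Suc k)
    show ?case
    proof (cases k)
      case 0
      then show ?thesis using p0(2) by (simp add: N_def degree_pderiv)
    next
      case (Suc l)
      then show ?thesis using Suc.IH Suc.prems dec[of k] by auto
    qed
  qed
  \<comment> \<open>Descending from \<open>k = N\<close>, where the bound is
    \<open>0\<close>.\<close>
  have lower: "N - k \<le> degree (p k)" if "k \<le> N" "1 \<le> k" for k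
    using that
  proof (induction k rule: inc_induct)
    case (step k)
    then show ?case using dec[of k] by auto
  qed simp
  have k: "1 \<le> k" "k \<le> N" using k by (auto simp: N_def)
  have "p k \<noteq> 0"
    using lower[of k] k last(1) by (cases "k = N") auto
  show ?thesis
  proof (cases "q k = 0")
    case False
    have "p k * q k = p (k + 1) + p (k - 1)" using rec[of k] k by auto
    moreover have "degree (p (k + 1)) \<le> N - k + 1"
      using upper[of "k + 1"] last(2) k by (cases "k = N") auto
    moreover have "degree (p (k - 1)) \<le> N - k + 1"
      using upper[of "k - 1"] k by (simp add: Suc_diff_le)
    ultimately have "degree (p k * q k) \<le> N - k + 1"
      by (simp add: degree_add_le)
    then have "degree (p k) + degree (q k) \<le> N - k + 1"
      using \<open>p k \<noteq> 0\<close> False by (simp add: degree_mult_eq)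
    then show ?thesis using lower[of k] k by auto
  qed simp
qed

text \<open>The value of the form at \<open>sturm_vec\<close> is \<open>t - \<alpha>\<close> times
  the square of \<open>P'(\<alpha>)\<close>, so dividing by \<open>P'(\<alpha>)\<close> normalises
  without a square root.\<close>

definition unit_vec_at :: "(nat \<Rightarrow> real poly) \<Rightarrow> complex \<Rightarrow> nat \<Rightarrow> complex" where
  "unit_vec_at p \<alpha> i = sturm_vec (\<lambda>k. map_poly of_real (p k)) \<alpha> i
     / poly (map_poly of_real (p 1)) \<alpha>"

text \<open>The pairing is bilinear, without conjugation, so the vectors of a nonreal root and of
  its conjugate are orthogonal. Squarefreeness makes \<open>P'\<close> nonzero at the roots.\<close>

lemma unit_vec_at_orthonormal:
  fixes p q :: "nat \<Rightarrow> real poly" and t :: real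
  assumes st: "sturm_functions P p q" and P: "0 < degree P" "rsquarefree (map_poly complex_of_real P)"
    and roots: "poly (map_poly of_real P) \<alpha> = 0" "poly (map_poly of_real P) \<beta> = 0"
  defines "N \<equiv> degree P"
  shows "(\<Sum>i<N. \<Sum>j<N. unit_vec_at p \<alpha> i * of_real (poly (Tri N q $$ (i, j)) t) * unit_vec_at p \<beta> j)
    = (if \<alpha> = \<beta> then of_real t - \<alpha> else 0)"
proof -
  let ?p = "\<lambda>k. map_poly complex_of_real (p k)" and ?q = "\<lambda>k. map_poly complex_of_real (q k)"
  have p0: "p 0 = P" "p 1 = pderiv P"
    and rec: "\<And>k. k \<in> {1..N} \<Longrightarrow> p (k + 1) = p k * q k - p (k - 1)"
    and last: "p (N + 1) = 0"
    using st by (auto simp: sturm_functions_def N_def)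
  interpret h: map_poly_comm_ring_hom complex_of_real ..
  have rec': "?p (k + 1) = ?p k * ?q k - ?p (k - 1)" if "k \<in> {1..N}" for k
    using rec[OF that] by (simp add: h.hom_minus h.hom_mult)
  have last': "?p (N + 1) = 0" using last by simp
  have deg': "degree (?q k) \<le> 1" if "k \<in> {1..N}" for k
    using sturm_degree_le_1[OF st] that degree_map_poly_le[of complex_of_real "q k"]
    by (auto simp: N_def intro: order_trans)
  have p1: "?p 1 = pderiv (?p 0)"
    using p0 by (simp add: of_real_hom.map_poly_pderiv)
  have nz: "poly (?p 1) \<gamma> \<noteq> 0" if "poly (map_poly of_real P) \<gamma> = 0" for \<gamma>
    using P(2) that p0(1) unfolding p1 rsquarefree_roots by auto
  have "(\<Sum>i<N. \<Sum>j<N. unit_vec_at p \<alpha> i * of_real (poly (Tri N q $$ (i, j)) t) * unit_vec_at p \<beta> j)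
    = (\<Sum>i<N. \<Sum>j<N. sturm_vec ?p \<alpha> i * Tri N (\<lambda>k. poly (?q k) (of_real t)) $$ (i, j) * sturm_vec ?p \<beta> j)
       / (poly (?p 1) \<alpha> * poly (?p 1) \<beta>)"
    unfolding sum_divide_distrib
    by (intro sum.cong refl) (auto simp: unit_vec_at_def Tri_def of_real_hom.poly_map_poly)
  also have "\<dots> = (if \<alpha> = \<beta> then of_real t - \<alpha> else 0)"
    using roots nz p0 P(1) unfolding N_def
    by (subst sturm_vec_orthogonal[where p = ?p and q = ?q, OF rec' last' deg', unfolded N_def])
      (auto simp flip: p1)
  finally show ?thesis .
qed

lemma cnj_unit_vec_at: "cnj (unit_vec_at p \<alpha> i) = unit_vec_at p (cnj \<alpha>) i"
  by (simp add: unit_vec_at_def sturm_vec_def poly_cnj_real coeff_map_poly)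

text \<open>Taking \<open>2 * Re\<close> of each coefficient adds the conjugate of \<open>c\<close>
  times the vector at \<open>\<alpha>\<close>, which yields a column over the real
  polynomials.\<close>

definition real_col :: "(nat \<Rightarrow> real poly) \<Rightarrow> complex \<Rightarrow> complex poly \<Rightarrow> nat \<Rightarrow> real poly" where
  "real_col p \<alpha> c i = map_poly (\<lambda>x. 2 * Re x) (smult (unit_vec_at p \<alpha> i) c)"

lemma poly_real_col:
  "of_real (poly (real_col p \<alpha> c i) t)
     = poly c (of_real t) * unit_vec_at p \<alpha> i + cnj (poly c (of_real t)) * unit_vec_at p (cnj \<alpha>) i"
proof -
  have "poly (map_poly (\<lambda>x. 2 * Re x) f) t = 2 * Re (poly f (of_real t))" for f
    by (induction f) (auto simp: map_poly_pCons algebra_simps)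
  then show ?thesis
    by (simp add: real_col_def complex_add_cnj mult.commute flip: cnj_unit_vec_at complex_cnj_mult)
qed

text \<open>Each column is a sum of two conjugate vectors, so the form splits into four pairings,
  which are conjugate in pairs. At a real root both conditions hold and both summands count.\<close>

lemma real_col_form:
  fixes p q :: "nat \<Rightarrow> real poly" and t :: real
  assumes st: "sturm_functions P p q" and P: "0 < degree P" "rsquarefree (map_poly complex_of_real P)"
    and roots: "poly (map_poly of_real P) \<alpha> = 0" "poly (map_poly of_real P) \<beta> = 0"
  defines "N \<equiv> degree P" and "u \<equiv> complex_of_real t"
  shows "poly (\<Sum>i<N. \<Sum>j<N. real_col p \<alpha> c i * Tri N q $$ (i, j) * real_col p \<beta> d j) t
    = 2 * Re ((if \<alpha> = \<beta> then poly c u * poly d u * (u - \<alpha>) else 0)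
        + (if \<alpha> = cnj \<beta> then poly c u * cnj (poly d u) * (u - \<alpha>) else 0))"
proof -
  define T where "T i j = complex_of_real (poly (Tri N q $$ (i, j)) t)" for i j
  have conj_root: "poly (map_poly of_real P) (cnj \<gamma>) = 0"
    if "poly (map_poly of_real P) \<gamma> = 0" for \<gamma>
    using that by (metis complex_cnj_zero poly_cnj_real coeff_map_poly of_real_0 Reals_of_real)
  have orth: "(\<Sum>i<N. \<Sum>j<N. unit_vec_at p \<gamma> i * T i j * unit_vec_at p \<delta> j)
      = (if \<gamma> = \<delta> then u - \<gamma> else 0)"
    if "poly (map_poly of_real P) \<gamma> = 0" "poly (map_poly of_real P) \<delta> = 0" for \<gamma> \<delta>
    using unit_vec_at_orthonormal[OF st P that, of t] by (simp add: T_def N_def u_def)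
  let ?c = "poly c u" and ?d = "poly d u"
  let ?s = "\<lambda>\<gamma> \<delta>. \<Sum>i<N. \<Sum>j<N. unit_vec_at p \<gamma> i * T i j * unit_vec_at p \<delta> j"
  have "complex_of_real (poly (\<Sum>i<N. \<Sum>j<N. real_col p \<alpha> c i * Tri N q $$ (i, j) * real_col p \<beta> d j) t)
    = (\<Sum>i<N. \<Sum>j<N. (?c * unit_vec_at p \<alpha> i + cnj ?c * unit_vec_at p (cnj \<alpha>) i) * T i j
        * (?d * unit_vec_at p \<beta> j + cnj ?d * unit_vec_at p (cnj \<beta>) j))"
    by (simp add: poly_sum poly_real_col T_def u_def)
  also have "\<dots> = ?c * ?d * ?s \<alpha> \<beta> + ?c * cnj ?d * ?s \<alpha> (cnj \<beta>)
      + cnj ?c * ?d * ?s (cnj \<alpha>) \<beta> + cnj ?c * cnj ?d * ?s (cnj \<alpha>) (cnj \<beta>)"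
    by (simp add: sum_distrib_left algebra_simps flip: sum.distrib)
  also have "\<dots> = (let w = (if \<alpha> = \<beta> then ?c * ?d * (u - \<alpha>) else 0)
        + (if \<alpha> = cnj \<beta> then ?c * cnj ?d * (u - \<alpha>) else 0) in w + cnj w)"
    unfolding orth[OF roots] orth[OF roots(1) conj_root[OF roots(2)]]
      orth[OF conj_root[OF roots(1)] roots(2)] orth[OF conj_root[OF roots(1)] conj_root[OF roots(2)]]
    by (auto simp: Let_def u_def)
  finally show ?thesis by (simp only: Let_def complex_add_cnj of_real_eq_iff)
qed

lemma transpose_mult_mult_entry:
  assumes "M \<in> carrier_mat n n" "U \<in> carrier_mat n n" "i < n" "j < n"
  shows "(transpose_mat U * M * U) $$ (i, j)
    = (\<Sum>k<n. \<Sum>l<n. U $$ (k, i) * M $$ (k, l) * U $$ (l, j))"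
  using assms
  by (auto simp: scalar_prod_def lessThan_atLeast0 sum_distrib_left mult.assoc intro!: sum.cong)

lemma to_fract_sum: "to_fract (sum f A) = (\<Sum>i\<in>A. to_fract (f i))"
  by (induction A rule: infinite_finite_induct) auto

text \<open>
  The multipliers \<open>c\<close> are chosen so that the pair of columns belonging to \<open>\<alpha>\<close> is
  orthogonal with values \<open>-1\<close> and \<open>quad_poly \<alpha>\<close>: the form at \<open>t\<close> pairs the columns of \<open>c\<close>
  and \<open>d\<close> to \<open>2 Re (c d (t - \<alpha>))\<close>.
\<close>

definition half_plane_unit :: "complex \<Rightarrow> complex" where
  "half_plane_unit \<alpha> = csqrt (- \<i> / of_real (2 * Im \<alpha>))"

text \<open>With \<open>c * c = - \<i> / (2 * Im \<alpha>)\<close>, the real part of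
  \<open>c * c * (t - \<alpha>)\<close> is constant in \<open>t\<close>. The factor \<open>d\<close>
  is chosen so that \<open>c * d * (t - \<alpha>)\<close> is \<open>\<i>\<close> times a product of
  two squared moduli, hence imaginary, and \<open>d * d * (t - \<alpha>)\<close> is minus the
  conjugate of the first expression times the squared modulus of \<open>t - \<alpha>\<close>, which
  is the value of \<open>quad_poly \<alpha>\<close> at \<open>t\<close>.\<close>

lemma half_plane_unit_identities:
  fixes t :: real
  assumes "0 < Im \<alpha>"
  defines "c \<equiv> half_plane_unit \<alpha>" and "d \<equiv> \<i> * (of_real t - cnj \<alpha>) * cnj (half_plane_unit \<alpha>)"
  shows "2 * Re (c * c * (of_real t - \<alpha>)) = - 1"
    and "Re (c * d * (of_real t - \<alpha>)) = 0"
    and "2 * Re (d * d * (of_real t - \<alpha>)) = poly (quad_poly \<alpha>) t"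
proof -
  have c2: "c * c = - \<i> / of_real (2 * Im \<alpha>)"
    unfolding c_def half_plane_unit_def by (metis power2_csqrt power2_eq_square)
  have c2': "c * c = Complex 0 (- 1 / (2 * Im \<alpha>))"
    unfolding c2 by (simp add: complex_eq_iff Re_divide_of_real Im_divide_of_real)
  then show c1: "2 * Re (c * c * (of_real t - \<alpha>)) = - 1"
    unfolding c2' using assms(1) by simp
  have "c * d * (of_real t - \<alpha>) = \<i> * (c * cnj c) * ((of_real t - \<alpha>) * cnj (of_real t - \<alpha>))"
    by (simp add: c_def d_def mult_ac)
  then show "Re (c * d * (of_real t - \<alpha>)) = 0"
    by (simp add: complex_mult_cnj del: complex_cnj_diff)
  have "d * d * (of_real t - \<alpha>)
      = - cnj (c * c * (of_real t - \<alpha>)) * ((of_real t - \<alpha>) * cnj (of_real t - \<alpha>))"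
    by (simp add: c_def d_def algebra_simps)
  also have "(of_real t - \<alpha>) * cnj (of_real t - \<alpha>) = of_real (poly (quad_poly \<alpha>) t)"
    by (simp add: complex_eq_iff quad_poly_def cmod_power2) (simp add: power2_eq_square algebra_simps)
  finally have dd: "d * d * (of_real t - \<alpha>)
      = - cnj (c * c * (of_real t - \<alpha>)) * of_real (poly (quad_poly \<alpha>) t)" .
  have "Re (- cnj w * of_real r) = - Re w * r" for w r by simp
  then have "Re (d * d * (of_real t - \<alpha>))
      = - Re (c * c * (of_real t - \<alpha>)) * poly (quad_poly \<alpha>) t"
    unfolding dd .
  then show "2 * Re (d * d * (of_real t - \<alpha>)) = poly (quad_poly \<alpha>) t"
    using c1 by simp
qed

section \<open>Assembling the diagonal form over all roots\<close>

lemma sum_atLeast1_atMost_eq: "(\<Sum>i = 1..n. f i) = (\<Sum>i<n. f (Suc i))"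
  by (rule sum.reindex_bij_witness[of _ Suc "\<lambda>i. i - 1"]) auto

lemma sum_lessThan_add:
  fixes f :: "nat \<Rightarrow> 'a::comm_monoid_add"
  shows "sum f {..<a + b} = sum f {..<a} + (\<Sum>i<b. f (a + i))"
  by (induction b) (auto simp: add.assoc)

theorem theorem1p45:
  fixes P :: "real poly" and n m :: nat
    and p q :: "nat \<Rightarrow> real poly"
    and x :: "nat \<Rightarrow> real" and z :: "nat \<Rightarrow> complex"
  assumes "lead_coeff P = 1"
    and "degree P = n + 2 * m"
    and "rsquarefree (map_poly complex_of_real P)"
    and "sturm_functions P p q"
    and "bij_betw x {1..n} {t. poly P t = 0}"
    and "bij_betw z {1..m} {w \<in> upper_half_plane. poly (map_poly complex_of_real P) w = 0}"
  shows "nonsingular_form (Tri (n + 2 * m) (\<lambda>k. to_fract (q k)))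
    \<and> witt_class (Tri (n + 2 * m) (\<lambda>k. to_fract (q k)))
         = (\<Sum>i=1..n. witt_class1 (to_fract [:- x i, 1:]))
           + (\<Sum>j=1..m. witt_class1 (to_fract (quad_poly (z j))))
           - (\<Sum>j=1..m. witt_class1 1)
    \<and> witt_class (Tri (n + 2 * m) (\<lambda>k. to_fract (q k)))
         = (\<Sum>i=1..n. witt_class1 1)
           + (\<Sum>i=1..n. witt_class1 (to_fract [:- x i, 1:]) - witt_class1 1)
           + (\<Sum>j=1..m. witt_class1 (to_fract (quad_poly (z j))) - witt_class1 1)"
proof -
  define N where "N = n + 2 * m"
  let ?Pc = "map_poly complex_of_real P"
  define M where "M = Tri N (\<lambda>k. to_fract (q k))"
  \<comment> \<open>The columns come in three blocks: the real roots, then the upper half plane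
    roots twice, once for the entry \<open>- 1\<close> and once for \<open>quad_poly\<close>.
    Conjugate roots are not listed, since \<open>real_col\<close> already includes them.\<close>
  define \<alpha> where "\<alpha> i = (if i < n then complex_of_real (x (Suc i))
    else if i < n + m then z (Suc (i - n)) else z (Suc (i - n - m)))" for i
  \<comment> \<open>At a real root the vector equals its conjugate, and \<open>1 / 2\<close> undoes
    the doubling in \<open>real_col\<close>. The last line is the multiplier \<open>d\<close> of
    \<open>half_plane_unit_identities\<close> with \<open>X\<close> for \<open>t\<close>.\<close>
  define c where "c i = (if i < n then [:1 / 2:]
    else if i < n + m then [:half_plane_unit (\<alpha> i):]
    else smult (\<i> * cnj (half_plane_unit (\<alpha> i))) [:- cnj (\<alpha> i), 1:])" for i
  define d where "d i = (if i < n then [:- x (Suc i), 1:]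
    else if i < n + m then - 1 else quad_poly (z (Suc (i - n - m))))" for i
  define U where "U = mat N N (\<lambda>(k, i). to_fract (real_col p (\<alpha> i) (c i) k))"
  define D where "D = mat N N (\<lambda>(i, j). if i = j then to_fract (d i) else 0)"
  have root_poly: "poly ?Pc (of_real r) = of_real (poly P r)" for r by simp
  have x_root: "poly P (x (Suc i)) = 0" if "i < n" for i
    using assms(5) that by (auto dest!: bij_betwE)
  have z_root: "0 < Im (z (Suc j)) \<and> poly ?Pc (z (Suc j)) = 0" if "j < m" for j
    using bij_betwE[OF assms(6)] that by (auto simp: upper_half_plane_def)
  have x_inj: "x (Suc i) = x (Suc j) \<longleftrightarrow> i = j" if "i < n" "j < n" for i j
    using bij_betw_imp_inj_on[OF assms(5)] that by (auto dest: inj_onD)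
  have z_inj: "z (Suc i) = z (Suc j) \<longleftrightarrow> i = j" if "i < m" "j < m" for i j
    using bij_betw_imp_inj_on[OF assms(6)] that by (auto dest: inj_onD)
  have z_ne: "z (Suc i) \<noteq> complex_of_real r" "complex_of_real r \<noteq> z (Suc i)"
      "complex_of_real r \<noteq> cnj (z (Suc i))" if "i < m" for i r
    using z_root[OF that] by (auto simp: complex_eq_iff)
  \<comment> \<open>This makes the second summand of \<open>real_col_form\<close> vanish for nonreal
    roots.\<close>
  have z_ne_cnj: "z (Suc i) \<noteq> cnj (z (Suc j))" if "i < m" "j < m" for i j
    using z_root[OF that(1)] z_root[OF that(2)] by (auto simp: complex_eq_iff)
  have \<alpha>_root: "poly ?Pc (\<alpha> i) = 0" if "i < N" for i
    using that x_root z_root[of "i - n"] z_root[of "i - n - m"]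
    by (auto simp: \<alpha>_def N_def root_poly)
  have \<alpha>_simps: "\<And>i. i < n \<Longrightarrow> \<alpha> i = complex_of_real (x (Suc i))"
      "\<And>k. k < m \<Longrightarrow> \<alpha> (n + k) = z (Suc k)" "\<And>k. \<alpha> (n + m + k) = z (Suc k)"
    by (auto simp: \<alpha>_def)
  have c_simps: "\<And>i. i < n \<Longrightarrow> c i = [:1 / 2:]"
      "\<And>k. k < m \<Longrightarrow> c (n + k) = [:half_plane_unit (z (Suc k)):]"
      "\<And>k. c (n + m + k) = smult (\<i> * cnj (half_plane_unit (z (Suc k)))) [:- cnj (z (Suc k)), 1:]"
    by (auto simp: c_def \<alpha>_def)
  have d_simps: "\<And>i. i < n \<Longrightarrow> d i = [:- x (Suc i), 1:]"
      "\<And>k. k < m \<Longrightarrow> d (n + k) = - 1" "\<And>k. d (n + m + k) = quad_poly (z (Suc k))"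
    by (auto simp: d_def)
  have index_cases: "i < n \<or> (\<exists>k<m. i = n + k) \<or> (\<exists>k<m. i = n + m + k)" if "i < N" for i
  proof -
    have "i < n \<or> (i - n < m \<and> i = n + (i - n)) \<or> (i - n - m < m \<and> i = n + m + (i - n - m))"
      using that by (auto simp: N_def)
    then show ?thesis by blast
  qed
  have entry: "(\<Sum>k<N. \<Sum>l<N. real_col p (\<alpha> i) (c i) k * Tri N q $$ (k, l) * real_col p (\<alpha> j) (c j) l)
      = (if i = j then d i else 0)" (is "?L = ?R") if ij: "i < N" "j < N" for i j
  proof -
    have deg: "degree P = N" by (simp add: assms(2) N_def)
    have pos: "0 < degree P" using ij by (simp add: deg)
    \<comment> \<open>An identity of real polynomials may be checked at every real \<open>t\<close>,
      where conjugation acts only on the coefficients.\<close>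
    have "poly ?L t = poly ?R t" for t
    proof -
      let ?ev = "\<lambda>i. poly (c i) (complex_of_real t)"
      have "poly ?L t = 2 * Re ((if \<alpha> i = \<alpha> j then ?ev i * ?ev j * (of_real t - \<alpha> i) else 0)
          + (if \<alpha> i = cnj (\<alpha> j) then ?ev i * cnj (?ev j) * (of_real t - \<alpha> i) else 0))"
        using real_col_form[OF assms(4) pos assms(3) \<alpha>_root[OF ij(1)] \<alpha>_root[OF ij(2)],
            of "c i" "c j" t]
        unfolding deg .
      also have "\<dots> = poly ?R t"
      proof -
        have ev: "\<And>i. i < n \<Longrightarrow> ?ev i = 1 / 2"
          "\<And>k. k < m \<Longrightarrow> ?ev (n + k) = half_plane_unit (z (Suc k))"
          "\<And>k. ?ev (n + m + k) = \<i> * (of_real t - cnj (z (Suc k))) * cnj (half_plane_unit (z (Suc k)))"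
          by (simp_all add: c_simps) (simp add: algebra_simps)
        note [simp] = ev \<alpha>_simps d_simps x_inj z_inj z_ne z_ne_cnj
        note [simp del] = times_complex.simps complex_cnj_diff
        \<comment> \<open>Cases 2 to 5 pair a real root with a nonreal one and give
          \<open>0\<close>; cases 6 to 9 need the identities only when \<open>k = l\<close>.\<close>
        consider "i < n" "j < n" | k where "i < n" "k < m" "j = n + k"
          | k where "i < n" "k < m" "j = n + m + k"
          | k where "j < n" "k < m" "i = n + k"
          | k where "j < n" "k < m" "i = n + m + k"
          | k l where "i = n + k" "k < m" "j = n + l" "l < m"
          | k l where "i = n + m + k" "k < m" "j = n + m + l" "l < m"
          | k l where "i = n + k" "k < m" "j = n + m + l" "l < m"
          | k l where "i = n + m + k" "k < m" "j = n + l" "l < m"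
          using index_cases[OF ij(1)] index_cases[OF ij(2)] by blast
        then show ?thesis
        proof cases
          case 1
          then show ?thesis by auto
        next
          case (6 k l)
          then show ?thesis using z_root[of k] half_plane_unit_identities(1)[of "z (Suc k)" t] by auto
        next
          case (7 k l)
          then show ?thesis using z_root[of k] half_plane_unit_identities(3)[of "z (Suc k)" t] by auto
        next
          case (8 k l)
          then show ?thesis using z_root[of k] half_plane_unit_identities(2)[of "z (Suc k)" t] by auto
        next
          case (9 k l)
          then show ?thesis using z_root[of k] half_plane_unit_identities(2)[of "z (Suc k)" t]
            by (auto simp: mult.commute)
        qed auto
      qed
      finally show ?thesis .
    qed
    then show ?thesis by (simp add: poly_eq_poly_eq_iff[symmetric] fun_eq_iff)
  qed
  have cM: "M \<in> carrier_mat N N" and cU: "U \<in> carrier_mat N N"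
    by (auto simp: M_def Tri_def U_def)
  have M_entry: "M $$ (k, l) = to_fract (Tri N q $$ (k, l))" if "k < N" "l < N" for k l
    using that by (auto simp: M_def Tri_def)
  have "transpose_mat U * M * U = D"
  proof (rule eq_matI)
    fix i j assume "i < dim_row D" "j < dim_col D"
    then have ij: "i < N" "j < N" by (auto simp: D_def)
    have "(transpose_mat U * M * U) $$ (i, j) = to_fract (if i = j then d i else 0)"
      unfolding transpose_mult_mult_entry[OF cM cU ij] entry[OF ij, symmetric]
      using ij by (simp add: to_fract_sum U_def M_entry)
    then show "(transpose_mat U * M * U) $$ (i, j) = D $$ (i, j)"
      using ij by (simp add: D_def)
  qed (use cU in \<open>auto simp: D_def\<close>)
  moreover have "transpose_mat M = M" by (auto simp: M_def Tri_def intro!: eq_matI)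
  moreover have "d i \<noteq> 0" for i by (auto simp: d_def quad_poly_def)
  then have diag: "nonsingular_form D" "witt_class D = (\<Sum>i<N. witt_class1 (to_fract (d i)))"
    using witt_class_diagonal[of N "\<lambda>i. to_fract (d i)"] by (auto simp: D_def)
  ultimately have "nonsingular_form M" "witt_class M = (\<Sum>i<N. witt_class1 (to_fract (d i)))"
    using nonsingular_form_congruent[OF cM _ cU diag(1)] isometric_imp_witt_class_eq by metis+
  moreover have "(\<Sum>i<N. witt_class1 (to_fract (d i)))
      = (\<Sum>i<n. witt_class1 (to_fract [:- x (Suc i), 1:]))
        + (\<Sum>j<m. witt_class1 (to_fract (quad_poly (z (Suc j))))) - (\<Sum>j<m. witt_class1 1)"
  proof -
    \<comment> \<open>Splitting the sum along the three blocks; the middle one consists of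
      \<open>m\<close> entries \<open>- 1\<close>, each contributing
      \<open>- witt_class1 1\<close>.\<close>
    have "N = n + m + m" by (simp add: N_def)
    then show ?thesis
      by (simp add: sum_lessThan_add d_simps witt_class1_uminus_one sum_negf)
  qed
  ultimately show ?thesis
    unfolding M_def N_def sum_atLeast1_atMost_eq by (simp add: sum_subtractf)
qed

end
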